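(* Let $J,R,E\in\mathbb{C}^{n,n}$ with $J^*=-J$, $R\succeq 0$, $E\succeq 0$, and let $sE+(J-R)$ be a regular pencil. Then $$\delta_0^d(J,R,E)^2=\min\left\{\delta_0^d(J,R)^2,\ \delta_0^d(J,E)^2,\ \inf_{\alpha\in\mathcal{M}_3}\left[\frac{\alpha^*J^*J\alpha}{\alpha^*\alpha}+\left(\frac{\alpha^*R^2\alpha}{\alpha^*R\alpha}\right)^2+\left(\frac{\alpha^*E^2\alpha}{\alpha^*E\alpha}\right)^2\right]\right\},$$ where $\mathcal{M}_3=\ker(R)^c\cap\ker(E)^c$ and $\delta_0^d(J,R)$, $\delta_0^d(J,E)$ are given as follows: (i) $\delta_0^d(J,R)^2=\infty$ if $\ker(E)=\{0\}$, and otherwise $$\delta_0^d(J,R)^2=\min\left\{\delta_0(J)^2,\ \inf_{\alpha\in\ker(E)\cap\ker(R)^c}\left[\frac{\alpha^*J^*J\alpha}{\alpha^*\alpha}+\left(\frac{\alpha^*R^2\alpha}{\alpha^*R\alpha}\right)^2\right]\right\};$$ (ii) $\delta_0^d(J,E)^2=\infty$ if $\ker(R)=\{0\}$, and otherwise $$\delta_0^d(J,E)^2=\min\left\{\delta_0(J)^2,\ \inf_{\alpha\in\ker(R)\cap\ker(E)^c}\left[\frac{\alpha^*J^*J\alpha}{\alpha^*\alpha}+\left(\frac{\alpha^*E^2\alpha}{\alpha^*E\alpha}\right)^2\right]\right\};$$ (iii) $\delta_0(J)^2=\infty$ if $\ker(R)\cap\ker(E)=\{0\}$, and otherwise $\delta_0(J)^2=\sigma_{\min}(JU)^2$,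 where the columns of $U$ form an orthonormal basis of $\ker(R)\cap\ker(E)$. Infima over empty sets are $+\infty$.
   Context: $\mathbb{C}^{n,n}$ is the set of complex $n\times n$ matrices; $X\succeq 0$ (resp. $X\preceq 0$) means $X$ is Hermitian positive (resp. negative) semidefinite; $\mathrm{SHerm}(n)$ is the set of skew-Hermitian $n\times n$ matrices; $\|\cdot\|$ is the spectral norm; $\sigma_{\min}$ is the smallest singular value; $S^c$ is the complement of $S$ in $\mathbb{C}^n$. A pencil $A+sE$ is regular if $A+\lambda E$ is invertible for some $\lambda\in\mathbb{C}$. A pencil $sE+(J-R)$ with $J^*=-J$, $R\succeq0$, $E\succeq0$ is called dissipative Hamiltonian (DH). The structured distances to a common null space are (with $\inf\emptyset=\infty$): $\delta_0^d(J,R,E)$ is the infimum of $\sqrt{\|\Delta_J\|^2+\|\Delta_R\|^2+\|\Delta_E\|^2}$ over all $\Delta_J\in\mathrm{SHerm}(n)$, $\Delta_R\preceq 0$, $\Delta_E\preceq 0$ with $R+\Delta_R\succeq 0$, $E+\Delta_E\succeq 0$ and $\ker(E+\Delta_E)\cap\ker(R+\Delta_R)\cap\ker(J+\Delta_J)\neq\{0\}$. $\delta_0^d(J,R)$ is the infimum of $\sqrt{\|\Delta_J\|^2+\|\Delta_R\|^2}$ over all $\Delta_J\in\mathrm{SHerm}(n)$, $\Delta_R\preceq 0$ with $R+\Delta_R\succeq 0$ and $\ker(E)\cap\ker(R+\Delta_R)\cap\ker(J+\Delta_J)\neq\{0\}$. $\delta_0^d(J,E)$ is the infimum of $\sqrt{\|\Delta_J\|^2+\|\Delta_E\|^2}$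 over all $\Delta_J\in\mathrm{SHerm}(n)$, $\Delta_E\preceq 0$ with $E+\Delta_E\succeq 0$ and $\ker(E+\Delta_E)\cap\ker(R)\cap\ker(J+\Delta_J)\neq\{0\}$. $\delta_0(J)$ is the infimum of $\|\Delta_J\|$ over all $\Delta_J\in\mathrm{SHerm}(n)$ with $\ker(E)\cap\ker(R)\cap\ker(J+\Delta_J)\neq\{0\}$. *)

theory Defs
  imports "HOL-Analysis.Analysis"
begin

definition adj :: "complex^'k^'m \<Rightarrow> complex^'m^'k"
  where "adj A = (\<chi> i j. cnj (A $ j $ i))"

definition cinner :: "complex^'n \<Rightarrow> complex^'n \<Rightarrow> complex"
  where "cinner x y = (\<Sum>i\<in>UNIV. cnj (x $ i) * y $ i)"

definition quad :: "complex^'n^'n \<Rightarrow> complex^'n \<Rightarrow> complex"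
  where "quad A x = cinner x (A *v x)"

text \<open>For Hermitian matrices the quadratic form is real-valued, so \<open>Re\<close> loses nothing.\<close>

definition psd :: "complex^'n^'n \<Rightarrow> bool"
  where "psd A \<longleftrightarrow> adj A = A \<and> (\<forall>x. 0 \<le> Re (quad A x))"

definition nsd :: "complex^'n^'n \<Rightarrow> bool"
  where "nsd A \<longleftrightarrow> adj A = A \<and> (\<forall>x. Re (quad A x) \<le> 0)"

definition skew_herm :: "complex^'n^'n \<Rightarrow> bool"
  where "skew_herm A \<longleftrightarrow> adj A = - A"

definition ker :: "complex^'k^'m \<Rightarrow> (complex^'k) set"
  where "ker A = {x. A *v x = 0}"

text \<open>The norm of \<^typ>\<open>complex^'n\<close> is the Euclidean one, so this is the spectral norm
  (and not the entrywise norm that \<open>norm\<close> would give on matrices).\<close>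

definition spec_norm :: "complex^'k^'m \<Rightarrow> real"
  where "spec_norm A = onorm ((*v) A)"

text \<open>Singular values via pairs of left and right singular vectors. For a tall matrix,
  0 occurs only if the columns are dependent (and for a wide one, the rows), so exactly the
  \<open>min m k\<close> usual singular values of an \<open>m\<close> by \<open>k\<close> matrix are obtained.\<close>

definition singular_value :: "complex^'k^'m \<Rightarrow> real \<Rightarrow> bool"
  where "singular_value A s \<longleftrightarrow> 0 \<le> s \<and>
    (\<exists>u v. norm u = 1 \<and> norm v = 1 \<and> A *v v = complex_of_real s *s u
      \<and> adj A *v u = complex_of_real s *s v)"

definition sigma_min :: "complex^'k^'m \<Rightarrow> real"
  where "sigma_min A = (LEAST s. singular_value A s)"

definition columns_onb :: "complex^'k^'n \<Rightarrow> (complex^'n) set \<Rightarrow> bool"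
  where "columns_onb U S \<longleftrightarrow>
    (\<forall>i j. cinner (column i U) (column j U) = (if i = j then 1 else 0)) \<and>
    vec.span (columns U) = S"

definition regular_pencil :: "complex^'n^'n \<Rightarrow> complex^'n^'n \<Rightarrow> bool"
  where "regular_pencil A E \<longleftrightarrow> (\<exists>s. invertible (A + map_matrix ((*) s) E))"

text \<open>The distances are \<^typ>\<open>ereal\<close>-valued, so that the infimum of the empty set is \<open>\<infinity>\<close>.
  The last three take all of \<open>J\<close>, \<open>R\<close>, \<open>E\<close> since they depend on the unperturbed matrices as well;
  the name lists the perturbed ones.\<close>

definition dist_JRE :: "complex^'n^'n \<Rightarrow> complex^'n^'n \<Rightarrow> complex^'n^'n \<Rightarrow> ereal"
  where "dist_JRE J R E = Inf {ereal (sqrt ((spec_norm DJ)\<^sup>2 + (spec_norm DR)\<^sup>2 + (spec_norm DE)\<^sup>2)) | DJ DR DE.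
    skew_herm DJ \<and> nsd DR \<and> nsd DE \<and> psd (R + DR) \<and> psd (E + DE) \<and>
    ker (E + DE) \<inter> ker (R + DR) \<inter> ker (J + DJ) \<noteq> {0}}"

definition dist_JR :: "complex^'n^'n \<Rightarrow> complex^'n^'n \<Rightarrow> complex^'n^'n \<Rightarrow> ereal"
  where "dist_JR J R E = Inf {ereal (sqrt ((spec_norm DJ)\<^sup>2 + (spec_norm DR)\<^sup>2)) | DJ DR.
    skew_herm DJ \<and> nsd DR \<and> psd (R + DR) \<and>
    ker E \<inter> ker (R + DR) \<inter> ker (J + DJ) \<noteq> {0}}"

definition dist_JE :: "complex^'n^'n \<Rightarrow> complex^'n^'n \<Rightarrow> complex^'n^'n \<Rightarrow> ereal"
  where "dist_JE J R E = Inf {ereal (sqrt ((spec_norm DJ)\<^sup>2 + (spec_norm DE)\<^sup>2)) | DJ DE.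
    skew_herm DJ \<and> nsd DE \<and> psd (E + DE) \<and>
    ker (E + DE) \<inter> ker R \<inter> ker (J + DJ) \<noteq> {0}}"

definition dist_J :: "complex^'n^'n \<Rightarrow> complex^'n^'n \<Rightarrow> complex^'n^'n \<Rightarrow> ereal"
  where "dist_J J R E = Inf {ereal (spec_norm DJ) | DJ.
    skew_herm DJ \<and> ker E \<inter> ker R \<inter> ker (J + DJ) \<noteq> {0}}"

text \<open>The quotients \<open>\<alpha>\<^sup>*J\<^sup>*J\<alpha> / \<alpha>\<^sup>*\<alpha>\<close> and \<open>\<alpha>\<^sup>*H\<^sup>2\<alpha> / \<alpha>\<^sup>*H\<alpha>\<close>, real for Hermitian \<open>H\<close>.\<close>

definition quot_skew :: "complex^'n^'n \<Rightarrow> complex^'n \<Rightarrow> real"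
  where "quot_skew J a = Re (quad (adj J ** J) a / cinner a a)"

definition quot_herm :: "complex^'n^'n \<Rightarrow> complex^'n \<Rightarrow> real"
  where "quot_herm H a = Re (quad (H ** H) a / quad H a)"

end

theory Submission
  imports Defs
begin

text \<open>A common null vector of the perturbed matrices can be prescribed. For a fixed nonzero \<open>a\<close>, the
constraints on \<open>\<Delta>\<^sub>J\<close>, \<open>\<Delta>\<^sub>R\<close> and \<open>\<Delta>\<^sub>E\<close> that place \<open>a\<close> in the three kernels do not interact, so
the distance is the infimum over \<open>a\<close> of a sum of three independent minimal costs, each of which
is a mapping problem \<open>\<Delta> a = y\<close> with structured \<open>\<Delta>\<close>.

For the skew-Hermitian part, \<open>\<Delta> a = - J a\<close> forces \<open>\<parallel>\<Delta>\<parallel> \<ge> \<parallel>J a\<parallel> / \<parallel>a\<parallel>\<close>. Equality is reached by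
a multiple \<open>-\<i>\<mu> H\<close> of a Householder reflection \<open>H\<close>, which is Hermitian and unitary
(\<open>skew_perturbation_exists\<close>). The reflection exists because \<open>a\<^sup>*J a\<close> is imaginary.

For a semidefinite part, \<open>\<Delta> a = - R a\<close> with \<open>\<Delta> \<preceq> 0\<close> forces \<open>\<parallel>\<Delta>\<parallel> \<ge> a\<^sup>*R\<^sup>2a / a\<^sup>*R a\<close> by
the Cauchy--Schwarz inequality for the form of \<open>-\<Delta>\<close> (\<open>psd_perturbation_lower\<close>). Equality is
reached by the rank-one matrix \<open>- (R a)(R a)\<^sup>* / a\<^sup>*R a\<close>, and \<open>R + \<Delta>\<close> stays semidefinite by
Cauchy--Schwarz for the form of \<open>R\<close> (\<open>psd_perturbation_exists\<close>).

If \<open>R a = 0\<close>, the right cost is 0, and \<open>quot_herm R a\<close> has this value as \<open>0 / 0\<close> is 0. Each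
squared distance is therefore the infimum of one expression over the nonzero vectors of a
suitable subspace. The theorem follows by splitting these index sets according to membership in
\<open>ker R\<close> and \<open>ker E\<close>. On \<open>ker R \<inter> ker E\<close> an orthonormal basis \<open>U\<close> turns \<open>\<parallel>J a\<parallel> / \<parallel>a\<parallel>\<close> into
\<open>\<parallel>J U v\<parallel> / \<parallel>v\<parallel>\<close>, whose minimum is the smallest singular value of \<open>J U\<close>.\<close>

section \<open>The complex inner product and the adjoint\<close>

lemma cinner_add_left: "cinner (x + y) z = cinner x z + cinner y z"
  by (simp add: cinner_def algebra_simps sum.distrib)

lemma cinner_add_right: "cinner x (y + z) = cinner x y + cinner x z"
  by (simp add: cinner_def algebra_simps sum.distrib)

lemma cinner_diff_left: "cinner (x - y) z = cinner x z - cinner y z"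
  by (simp add: cinner_def algebra_simps sum_subtractf)

lemma cinner_diff_right: "cinner x (y - z) = cinner x y - cinner x z"
  by (simp add: cinner_def algebra_simps sum_subtractf)

lemma cinner_minus_left [simp]: "cinner (- x) y = - cinner x y"
  by (simp add: cinner_def sum_negf)

lemma cinner_minus_right [simp]: "cinner x (- y) = - cinner x y"
  by (simp add: cinner_def sum_negf)

lemma cinner_zero_left [simp]: "cinner 0 x = 0"
  by (simp add: cinner_def)

lemma cinner_zero_right [simp]: "cinner x 0 = 0"
  by (simp add: cinner_def)

lemma cinner_scale_left: "cinner (c *s x) y = cnj c * cinner x y"
  by (simp add: cinner_def sum_distrib_left mult.assoc)

lemma cinner_scale_right: "cinner x (c *s y) = c * cinner x y"
  by (simp add: cinner_def sum_distrib_left mult_ac)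

lemmas cinner_simps = cinner_add_left cinner_add_right cinner_diff_left cinner_diff_right
  cinner_scale_left cinner_scale_right

lemma cnj_cinner: "cnj (cinner x y) = cinner y x"
  by (simp add: cinner_def mult.commute)

lemma Re_cinner: "Re (cinner x y) = x \<bullet> y"
  by (simp add: cinner_def inner_vec_def inner_complex_def)

lemma Re_cinner_self: "Re (cinner x x) = (norm x)\<^sup>2"
  by (simp add: Re_cinner power2_norm_eq_inner)

lemma cinner_self: "cinner x x = complex_of_real ((norm x)\<^sup>2)"
proof -
  have "cnj (cinner x x) = cinner x x" by (rule cnj_cinner)
  then have "Im (cinner x x) = 0" by (simp add: complex_eq_iff)
  then show ?thesis by (simp add: complex_eq_iff Re_cinner_self)
qed

lemma norm_vec_scale: "norm (c *s x) = cmod c * norm (x :: complex^'n)"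
proof -
  have "cinner (c *s x) (c *s x) = cnj c * c * cinner x x"
    by (simp add: cinner_simps)
  also have "cnj c * c = complex_of_real ((cmod c)\<^sup>2)"
    by (metis complex_norm_square mult.commute)
  finally have "(norm (c *s x))\<^sup>2 = (cmod c * norm x)\<^sup>2"
    by (simp only: cinner_self of_real_mult[symmetric] of_real_eq_iff power_mult_distrib)
  then show ?thesis by simp
qed

lemma cinner_mult_right: "cinner x (A *v y) = cinner (adj A *v x) y"
proof -
  have "cinner x (A *v y) = (\<Sum>i\<in>UNIV. \<Sum>j\<in>UNIV. cnj (x $ i) * (A $ i $ j * y $ j))"
    by (simp add: cinner_def matrix_vector_mult_def sum_distrib_left)
  also have "\<dots> = (\<Sum>j\<in>UNIV. \<Sum>i\<in>UNIV. cnj (x $ i) * (A $ i $ j * y $ j))"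
    by (rule sum.swap)
  also have "\<dots> = cinner (adj A *v x) y"
    by (simp add: cinner_def adj_def matrix_vector_mult_def sum_distrib_left mult_ac)
  finally show ?thesis .
qed

lemma adj_adj [simp]: "adj (adj A) = A"
  by (simp add: adj_def vec_eq_iff)

lemma adj_add: "adj (A + B) = adj A + adj B"
  by (simp add: adj_def vec_eq_iff)

lemma adj_minus: "adj (- A) = - adj A"
  by (simp add: adj_def vec_eq_iff)

lemma adj_mult: "adj (A ** B) = adj B ** adj A"
  by (simp add: adj_def vec_eq_iff matrix_matrix_mult_def mult.commute)

lemma cinner_mult_left: "cinner (A *v x) y = cinner x (adj A *v y)"
  by (simp add: cinner_mult_right)

lemma uminus_matrix_vector_mult: "(- A) *v x = - (A *v (x :: complex^'k))"
  by (simp add: vec_eq_iff matrix_vector_mult_def sum_negf)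

lemma quad_gram: "quad (adj A ** A) x = complex_of_real ((norm (A *v x))\<^sup>2)"
  by (simp add: quad_def matrix_vector_mul_assoc[symmetric] cinner_mult_right cinner_self)

lemma quad_hermitian_real:
  assumes "adj H = H"
  shows "quad H x = complex_of_real (Re (quad H x))"
proof -
  have "cnj (quad H x) = quad H x"
    using assms by (simp add: quad_def cnj_cinner cinner_mult_left)
  then show ?thesis by (simp add: complex_eq_iff)
qed

lemma quad_add: "quad (A + B) x = quad A x + quad B x"
  by (simp add: quad_def matrix_vector_mult_add_rdistrib cinner_simps)

lemma quad_uminus: "quad (- A) x = - quad A x"
  by (simp add: quad_def uminus_matrix_vector_mult)

section \<open>The spectral norm\<close>

lemma norm_mult_le_spec_norm: "norm (A *v x) \<le> spec_norm A * norm (x :: complex^'k)"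
  unfolding spec_norm_def by (rule onorm) simp

lemma spec_norm_nonneg: "0 \<le> spec_norm A"
  unfolding spec_norm_def by (rule onorm_pos_le) simp

lemma spec_norm_le:
  "(\<And>x. norm (A *v x) \<le> b * norm x) \<Longrightarrow> spec_norm A \<le> b"
  unfolding spec_norm_def by (rule onorm_le)

lemma spec_norm_uminus: "spec_norm (- A) = spec_norm A"
proof -
  have "(*v) (- A) = (\<lambda>x. - (A *v x))"
    by (rule ext) (rule uminus_matrix_vector_mult)
  then show ?thesis by (simp add: spec_norm_def onorm_neg)
qed

section \<open>Rank-one and scaled matrices\<close>

definition outer :: "complex^'m \<Rightarrow> complex^'k \<Rightarrow> complex^'k^'m"
  where "outer u w = (\<chi> i j. u $ i * cnj (w $ j))"

lemma outer_mult: "outer u w *v x = cinner w x *s u"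
  by (simp add: vec_eq_iff outer_def matrix_vector_mult_def cinner_def sum_distrib_left mult_ac)

lemma scaled_mult: "map_matrix ((*) c) A *v x = c *s (A *v (x :: complex^'k))"
  by (simp add: vec_eq_iff matrix_vector_mult_def map_matrix_def sum_distrib_left mult_ac)

lemma adj_scaled: "adj (map_matrix ((*) c) A) = map_matrix ((*) (cnj c)) (adj A)"
  by (simp add: vec_eq_iff adj_def map_matrix_def)

lemma adj_outer: "adj (outer u w) = outer w u"
  by (simp add: vec_eq_iff adj_def outer_def mult.commute)

section \<open>Cauchy--Schwarz for semidefinite forms\<close>

lemma psd_quad_nonneg: "psd A \<Longrightarrow> 0 \<le> Re (quad A x)"
  by (simp add: psd_def)

lemma psd_form_sym: "psd A \<Longrightarrow> cnj (cinner x (A *v y)) = cinner y (A *v x)"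
  by (simp add: psd_def cnj_cinner cinner_mult_left)

text \<open>The form along the line through \<open>y\<close> in direction \<open>x\<close>; its nonnegativity for a well-chosen
coefficient \<open>c\<close> is the source of the Cauchy--Schwarz inequality.\<close>

lemma psd_quad_diff:
  assumes "psd A"
  shows "Re (quad A (y - c *s x)) =
    Re (quad A y) - 2 * Re (c * cinner y (A *v x)) + (cmod c)\<^sup>2 * Re (quad A x)"
proof -
  have 1: "cinner x (A *v y) = cnj (cinner y (A *v x))"
    using psd_form_sym[OF assms] by metis
  have q: "quad A x = complex_of_real (Re (quad A x))"
    using assms quad_hermitian_real by (auto simp: psd_def)
  have "quad A (y - c *s x) = quad A y - c * cinner y (A *v x)
      - cnj (c * cinner y (A *v x)) + (c * cnj c) * quad A x"
    by (simp add: quad_def matrix_vector_mult_diff_distrib vector_scalar_commute cinner_simps 1 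
        algebra_simps)
  also have "c * cnj c = complex_of_real ((cmod c)\<^sup>2)"
    by (rule complex_norm_square[symmetric])
  also have "quad A x = complex_of_real (Re (quad A x))" by (rule q)
  finally show ?thesis by simp
qed

lemma psd_cauchy_schwarz_aux:
  assumes "psd A" and "0 < Re (quad A x)"
  shows "(cmod (cinner x (A *v y)))\<^sup>2 \<le> Re (quad A x) * Re (quad A y)"
proof -
  define q where "q = Re (quad A x)"
  define z where "z = cinner x (A *v y)"
  have z: "cinner y (A *v x) = cnj z"
    using psd_form_sym[OF assms(1)] by (simp add: z_def)
  have zz: "z * cnj z = complex_of_real ((cmod z)\<^sup>2)" by (rule complex_norm_square[symmetric])
  \<comment> \<open>The minimizer of the form along this line.\<close>
  have "0 \<le> Re (quad A (y - (z / of_real q) *s x))"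
    by (rule psd_quad_nonneg[OF assms(1)])
  also have "\<dots> = Re (quad A y) - 2 * Re (z * cnj z / of_real q) + (cmod z / q)\<^sup>2 * q"
    using assms(2) by (subst psd_quad_diff[OF assms(1)]) (simp add: z q_def norm_divide)
  also have "\<dots> = Re (quad A y) - (cmod z)\<^sup>2 / q"
    using assms(2) unfolding zz q_def[symmetric]
    by (simp add: power2_eq_square field_simps flip: of_real_mult of_real_divide)
  finally show ?thesis
    using assms(2) by (simp add: q_def z_def field_simps)
qed

text \<open>The form may be degenerate. When it vanishes at both vectors, the expansion along a line has no
quadratic term, so a mixed term of the wrong sign would make it negative.\<close>

lemma psd_cauchy_schwarz:
  assumes "psd A"
  shows "(cmod (cinner x (A *v y)))\<^sup>2 \<le> Re (quad A x) * Re (quad A y)"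
proof -
  have sym: "cmod (cinner x (A *v y)) = cmod (cinner y (A *v x))"
    using psd_form_sym[OF assms, of x y] by (metis complex_mod_cnj)
  consider "0 < Re (quad A x)" | "0 < Re (quad A y)" | "Re (quad A x) = 0" "Re (quad A y) = 0"
    using psd_quad_nonneg[OF assms] by (meson not_le_imp_less order_antisym_conv)
  then show ?thesis
  proof cases
    case 1
    then show ?thesis by (rule psd_cauchy_schwarz_aux[OF assms])
  next
    case 2
    then show ?thesis
      using psd_cauchy_schwarz_aux[OF assms 2, of x] by (simp add: sym mult.commute)
  next
    case 3
    define z where "z = cinner y (A *v x)"
    have "0 \<le> Re (quad A (y - cnj z *s x))"
      by (rule psd_quad_nonneg[OF assms])
    also have "\<dots> = - 2 * Re (z * cnj z)"
      by (subst psd_quad_diff[OF assms]) (simp add: 3 z_def mult.commute)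
    also have "z * cnj z = complex_of_real ((cmod z)\<^sup>2)" by (rule complex_norm_square[symmetric])
    finally have "cmod z = 0" by simp
    then show ?thesis by (simp add: 3 sym z_def)
  qed
qed

text \<open>Cauchy--Schwarz for the pair \<open>x\<close>, \<open>A x\<close>: the mixed term \<open>x\<^sup>*A(A x)\<close> is \<open>\<parallel>A x\<parallel>\<^sup>2\<close>, and the form at
\<open>A x\<close> is at most \<open>\<parallel>A\<parallel> \<parallel>A x\<parallel>\<^sup>2\<close>.\<close>

lemma psd_norm_mult_le:
  assumes "psd A"
  shows "(norm (A *v x))\<^sup>2 \<le> spec_norm A * Re (quad A x)"
proof (cases "A *v x = 0")
  case True
  then show ?thesis by (simp add: quad_def)
next
  case False
  define p where "p = A *v x"
  have p: "p \<noteq> 0" using False by (simp add: p_def)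
  have "cinner x (A *v p) = cinner p p"
    using assms by (simp add: psd_def cinner_mult_right p_def)
  then have "((norm p)\<^sup>2)\<^sup>2 \<le> Re (quad A x) * Re (quad A p)"
    using psd_cauchy_schwarz[OF assms, of x p] by (simp add: cinner_self norm_power)
  also have "Re (quad A p) \<le> spec_norm A * (norm p)\<^sup>2"
  proof -
    have "Re (quad A p) \<le> norm p * norm (A *v p)"
      by (simp add: quad_def Re_cinner norm_cauchy_schwarz)
    also have "\<dots> \<le> norm p * (spec_norm A * norm p)"
      by (intro mult_left_mono norm_mult_le_spec_norm) simp
    finally show ?thesis by (simp add: power2_eq_square mult_ac)
  qed
  then have "Re (quad A x) * Re (quad A p) \<le> Re (quad A x) * (spec_norm A * (norm p)\<^sup>2)"
    by (rule mult_left_mono) (rule psd_quad_nonneg[OF assms])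
  finally have "(norm p)\<^sup>2 * (norm p)\<^sup>2 \<le> (spec_norm A * Re (quad A x)) * (norm p)\<^sup>2"
    by (simp add: power2_eq_square mult_ac)
  then have "(norm p)\<^sup>2 \<le> spec_norm A * Re (quad A x)"
    by (rule mult_right_le_imp_le) (simp add: p)
  then show ?thesis by (simp add: p_def)
qed

lemma psd_quad_eq_0_iff:
  assumes "psd A"
  shows "Re (quad A x) = 0 \<longleftrightarrow> A *v x = 0"
  using psd_norm_mult_le[OF assms, of x] by (auto simp: quad_def)

lemma psd_one: "psd (mat 1)"
proof -
  have "adj (mat 1) = (mat 1 :: complex^'n^'n)"
    by (auto simp: adj_def mat_def vec_eq_iff)
  then show ?thesis by (simp add: psd_def quad_def Re_cinner)
qed

lemma cinner_cauchy_schwarz: "cmod (cinner x y) \<le> norm x * norm y"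
proof -
  have "(cmod (cinner x y))\<^sup>2 \<le> (norm x * norm y)\<^sup>2"
    using psd_cauchy_schwarz[OF psd_one, of x y]
    by (simp add: quad_def Re_cinner_self power_mult_distrib)
  then show ?thesis by (rule power2_le_imp_le) simp
qed

section \<open>Smallest perturbations that annihilate a vector\<close>

lemma quot_skew_eq: "quot_skew J a = (norm (J *v a) / norm a)\<^sup>2"
  unfolding quot_skew_def quad_gram cinner_self
  by (simp add: power_divide flip: of_real_divide)

lemma quot_herm_eq:
  assumes "adj H = H"
  shows "quot_herm H a = (norm (H *v a))\<^sup>2 / Re (quad H a)"
proof -
  have "quad (H ** H) a = complex_of_real ((norm (H *v a))\<^sup>2)"
    using quad_gram[of H a] assms by simp
  then show ?thesis
    unfolding quot_herm_def by (subst quad_hermitian_real[OF assms]) simp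
qed

lemma quot_herm_kernel:
  assumes "a \<in> ker H" shows "quot_herm H a = 0"
  using assms by (simp add: quot_herm_def ker_def quad_def)

text \<open>The Householder reflection in the hyperplane orthogonal to \<open>x - h\<close> exchanges \<open>x\<close> and \<open>h\<close>. Over
the complex numbers this needs \<open>x\<^sup>*h\<close> to be real in addition to equal norms.\<close>

lemma hermitian_isometry_transport:
  fixes x h :: "complex^'n"
  assumes "norm h = norm x" and "cinner h x = cinner x h"
  obtains H where "adj H = H" and "H *v x = h" and "\<And>v. norm (H *v v) = norm v"
proof
  define u where "u = x - h"
  \<comment> \<open>For \<open>u = 0\<close> the division by zero makes this the identity, which is right since then \<open>x = h\<close>.\<close>
  define H where "H = mat 1 + outer ((- complex_of_real (2 / (norm u)\<^sup>2)) *s u) u"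
  have H: "H *v v = v - (2 * cinner u v / cinner u u) *s u" for v
    by (simp add: H_def matrix_vector_mult_add_rdistrib outer_mult vec_eq_iff cinner_self)
  show "adj H = H"
    by (auto simp: H_def vec_eq_iff adj_def outer_def mat_def)
  show "H *v x = h"
  proof (cases "u = 0")
    case True
    then show ?thesis by (simp add: H u_def)
  next
    case False
    have "2 * cinner u x = cinner u u"
      using assms by (simp add: u_def cinner_simps cinner_self[of x] cinner_self[of h])
    then show ?thesis using False by (simp add: H u_def cinner_self)
  qed
  show "norm (H *v v) = norm v" for v
  proof (cases "u = 0")
    case True
    then show ?thesis by (simp add: H)
  next
    case False
    define c where "c = cinner u v"
    define q where "q = cinner u u"
    have q: "q \<noteq> 0" "cnj q = q" using False by (simp_all add: q_def cinner_self)
    have "cinner v u = cnj c" by (simp add: c_def cnj_cinner)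
    then have "cinner (H *v v) (H *v v) = cinner v v"
      using q by (simp add: H cinner_simps c_def[symmetric] q_def[symmetric] field_simps)
    then have "(norm (H *v v))\<^sup>2 = (norm v)\<^sup>2"
      using Re_cinner_self by metis
    then show ?thesis by simp
  qed
qed

lemma skew_quad_imaginary:
  assumes "skew_herm J"
  shows "cnj (cinner x (J *v x)) = - cinner x (J *v x)"
  using assms by (simp add: skew_herm_def cnj_cinner cinner_mult_left uminus_matrix_vector_mult)

lemma skew_perturbation_lower:
  assumes "x \<in> ker (J + D)" and "x \<noteq> 0"
  shows "quot_skew J x \<le> (spec_norm D)\<^sup>2"
proof -
  have "D *v x = - (J *v x)"
    using assms(1) by (simp add: ker_def matrix_vector_mult_add_rdistrib eq_neg_iff_add_eq_0 add.commute)
  then have "norm (J *v x) \<le> spec_norm D * norm x"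
    using norm_mult_le_spec_norm[of D x] by simp
  then have "norm (J *v x) / norm x \<le> spec_norm D"
    using assms(2) by (simp add: field_simps)
  then show ?thesis
    by (simp add: quot_skew_eq power_mono)
qed

lemma skew_perturbation_exists:
  fixes J :: "complex^'n^'n"
  assumes "skew_herm J" and "x \<noteq> 0"
  shows "\<exists>D. skew_herm D \<and> x \<in> ker (J + D) \<and> (spec_norm D)\<^sup>2 \<le> quot_skew J x"
proof (cases "J *v x = 0")
  case True
  have "skew_herm (0 :: complex^'n^'n)" by (simp add: skew_herm_def adj_def vec_eq_iff)
  moreover have "spec_norm (0 :: complex^'n^'n) = 0"
    using spec_norm_le[of "0 :: complex^'n^'n" 0] spec_norm_nonneg[of "0 :: complex^'n^'n"] by simp
  ultimately show ?thesis
    using True by (intro exI[of _ 0]) (simp add: ker_def quot_skew_eq)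
next
  case False
  define \<mu> where "\<mu> = norm (J *v x) / norm x"
  have \<mu>: "\<mu> > 0" using False assms(2) by (simp add: \<mu>_def)
  \<comment> \<open>Dividing by \<open>\<i>\<close> makes the imaginary number \<open>x\<^sup>*J x\<close> real, and dividing by \<open>\<mu>\<close> equates the norms.\<close>
  define h where "h = (- \<i> / of_real \<mu>) *s (J *v x)"
  have "norm h = norm x"
    using False assms(2) \<mu> by (simp add: h_def norm_vec_scale norm_divide) (simp add: \<mu>_def)
  moreover have "cinner h x = cinner x h"
    using skew_quad_imaginary[OF assms(1), of x] by (simp add: h_def cinner_simps cnj_cinner)
  ultimately obtain H where H: "adj H = H" "H *v x = h" "\<And>v. norm (H *v v) = norm v"
    using hermitian_isometry_transport by metis
  define D where "D = map_matrix ((*) (- \<i> * of_real \<mu>)) H"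
  have "skew_herm D"
    by (simp add: skew_herm_def D_def adj_scaled H) (simp add: vec_eq_iff map_matrix_def)
  moreover have "x \<in> ker (J + D)"
    using \<mu> by (simp add: ker_def matrix_vector_mult_add_rdistrib D_def scaled_mult H h_def vec_eq_iff)
  moreover have "spec_norm D \<le> \<mu>"
    using \<mu> by (intro spec_norm_le) (simp add: D_def scaled_mult norm_vec_scale H norm_mult)
  then have "(spec_norm D)\<^sup>2 \<le> quot_skew J x"
    unfolding quot_skew_eq \<mu>_def by (rule power_mono) (rule spec_norm_nonneg)
  ultimately show ?thesis by blast
qed

text \<open>The matrices \<open>-D\<close> and \<open>R\<close> agree at \<open>x\<close>, so the numerator and denominator of the quotient can be
computed from \<open>-D\<close>, where they differ by a factor of at most \<open>\<parallel>D\<parallel>\<close>.\<close>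

lemma psd_perturbation_lower:
  assumes "psd R" and "nsd D" and "x \<in> ker (R + D)"
  shows "(quot_herm R x)\<^sup>2 \<le> (spec_norm D)\<^sup>2"
proof -
  have psd: "psd (- D)" using assms(2) by (simp add: nsd_def psd_def adj_minus quad_uminus)
  have eq: "(- D) *v x = R *v x"
    using assms(3) by (simp add: ker_def matrix_vector_mult_add_rdistrib uminus_matrix_vector_mult
        neg_eq_iff_add_eq_0 add.commute)
  then have "quad (- D) x = quad R x" by (simp add: quad_def)
  then have "(norm (R *v x))\<^sup>2 \<le> spec_norm D * Re (quad R x)"
    using psd_norm_mult_le[OF psd, of x] by (simp add: eq spec_norm_uminus)
  moreover have "0 \<le> Re (quad R x)" by (rule psd_quad_nonneg[OF assms(1)])
  ultimately have "(norm (R *v x))\<^sup>2 / Re (quad R x) \<le> spec_norm D"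
    using spec_norm_nonneg[of D] by (cases "Re (quad R x) = 0") (simp_all add: divide_le_eq)
  then have "quot_herm R x \<le> spec_norm D"
    using assms(1) by (simp add: quot_herm_eq psd_def)
  moreover have "0 \<le> quot_herm R x"
    using assms(1) by (simp add: quot_herm_eq psd_def)
  ultimately show ?thesis by (simp add: power_mono)
qed

lemma psd_perturbation_exists:
  assumes "psd R"
  shows "\<exists>D. nsd D \<and> psd (R + D) \<and> x \<in> ker (R + D) \<and> (spec_norm D)\<^sup>2 \<le> (quot_herm R x)\<^sup>2"
proof -
  define p where "p = R *v x"
  define q where "q = Re (quad R x)"
  \<comment> \<open>The candidate \<open>- p p\<^sup>* / q\<close>; it is 0 when \<open>q = 0\<close>, which is the case \<open>R x = 0\<close>.\<close>
  define D where "D = outer ((- complex_of_real (1 / q)) *s p) p"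
  have q: "0 \<le> q" "quad R x = of_real q"
    using psd_quad_nonneg[OF assms] quad_hermitian_real assms by (auto simp: q_def psd_def)
  have p0: "p = 0" if "q = 0"
    using that psd_quad_eq_0_iff[OF assms] by (simp add: q_def p_def)
  have sym: "adj R = R" using assms by (simp add: psd_def)
  have D: "D *v v = (- (cinner p v / of_real q)) *s p" for v
    by (simp add: D_def outer_mult vec_eq_iff)
  have adjD: "adj D = D"
    by (simp add: D_def adj_outer) (simp add: outer_def vec_eq_iff)
  have pv: "cinner p v = cinner x (R *v v)" for v
    by (simp add: p_def cinner_mult_left sym)
  have quadD: "Re (quad D v) = - (cmod (cinner p v))\<^sup>2 / q" for v
  proof -
    have "quad D v = - (cinner p v * cnj (cinner p v)) / of_real q"
      by (simp add: quad_def D cinner_simps cnj_cinner)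
    also have "cinner p v * cnj (cinner p v) = of_real ((cmod (cinner p v))\<^sup>2)"
      by (rule complex_norm_square[symmetric])
    finally show ?thesis by simp
  qed
  have "nsd D"
    using q by (simp add: nsd_def adjD quadD)
  moreover have "psd (R + D)"
  proof -
    have "0 \<le> Re (quad (R + D) v)" for v
    proof (cases "q = 0")
      case True
      then show ?thesis
        using psd_quad_nonneg[OF assms] by (simp add: quad_add quadD)
    next
      case False
      then show ?thesis
        using psd_cauchy_schwarz[OF assms, of x v] q(1)
        by (simp add: quad_add quadD pv q_def[symmetric] field_simps)
    qed
    then show ?thesis by (simp add: psd_def adj_add adjD sym)
  qed
  moreover have "x \<in> ker (R + D)"
  proof (cases "q = 0")
    case True
    then show ?thesis
      using p0 by (simp add: ker_def matrix_vector_mult_add_rdistrib D p_def[symmetric])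
  next
    case False
    have "cinner p x = of_real q" by (simp add: pv q(2)[symmetric] quad_def)
    then show ?thesis
      using False by (simp add: ker_def matrix_vector_mult_add_rdistrib D p_def[symmetric])
  qed
  moreover have "spec_norm D \<le> quot_herm R x"
  proof (rule spec_norm_le)
    fix v
    have "norm (D *v v) = cmod (cinner p v) * norm p / q"
      using q(1) by (simp add: D norm_vec_scale norm_divide)
    also have "\<dots> \<le> (norm p * norm v) * norm p / q"
      using q(1) by (intro divide_right_mono mult_right_mono cinner_cauchy_schwarz) auto
    finally show "norm (D *v v) \<le> quot_herm R x * norm v"
      by (simp add: quot_herm_eq sym p_def[symmetric] q_def[symmetric] power2_eq_square mult_ac)
  qed
  then have "(spec_norm D)\<^sup>2 \<le> (quot_herm R x)\<^sup>2"
    by (rule power_mono) (rule spec_norm_nonneg)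
  ultimately show ?thesis by blast
qed

section \<open>The smallest singular value\<close>

lemma singular_value_attained:
  assumes "singular_value A s"
  obtains v where "norm v = 1" and "norm (A *v v) = s"
  using assms by (auto simp: singular_value_def norm_vec_scale)

lemma minimal_stretch_attained:
  fixes A :: "complex^'k^'m"
  obtains v where "norm v = 1" and "\<And>w. norm (A *v v) * norm w \<le> norm (A *v w)"
proof -
  have "compact (sphere (0 :: complex^'k) 1)" by simp
  moreover have "sphere (0 :: complex^'k) 1 \<noteq> {}" by simp
  moreover have "continuous_on (sphere 0 1) (\<lambda>v. norm (A *v v))"
    by (intro continuous_intros linear_continuous_on) simp
  ultimately obtain v where v: "v \<in> sphere 0 1"
    and min: "\<And>w. w \<in> sphere 0 1 \<Longrightarrow> norm (A *v v) \<le> norm (A *v w)"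
    using continuous_attains_inf by metis
  have "norm (A *v v) * norm w \<le> norm (A *v w)" for w
  proof (cases "w = 0")
    case False
    have "w /\<^sub>R norm w \<in> sphere 0 1" using False by simp
    moreover have "norm (A *v (w /\<^sub>R norm w)) = norm (A *v w) / norm w"
      by (simp add: linear_cmul[OF matrix_vector_mul_linear] divide_inverse mult.commute)
    ultimately have "norm (A *v v) \<le> norm (A *v w) / norm w"
      using min by metis
    then show ?thesis
      using False by (simp add: field_simps)
  qed simp
  with v that show thesis by simp
qed

text \<open>With \<open>s\<close> the minimal stretch, \<open>A\<^sup>*A - s\<^sup>2I\<close> is positive semidefinite and its form vanishes at
the minimizer. A semidefinite matrix annihilates every vector at which its form vanishes.\<close>

lemma gram_eigenvector:
  fixes A :: "complex^'k^'m"
  assumes "norm v = 1" and min: "\<And>w. norm (A *v v) * norm w \<le> norm (A *v w)"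
  shows "adj A *v (A *v v) = complex_of_real ((norm (A *v v))\<^sup>2) *s v"
proof -
  define s where "s = norm (A *v v)"
  define B where "B = adj A ** A - map_matrix ((*) (complex_of_real (s\<^sup>2))) (mat 1)"
  have B: "B *v w = adj A *v (A *v w) - complex_of_real (s\<^sup>2) *s w" for w
    by (simp add: B_def matrix_vector_mult_diff_rdistrib scaled_mult matrix_vector_mul_assoc)
  have quadB: "Re (quad B w) = (norm (A *v w))\<^sup>2 - (s * norm w)\<^sup>2" for w
    by (simp add: quad_def B cinner_simps cinner_mult_right cinner_self power_mult_distrib
        flip: of_real_mult of_real_power)
  have "adj B = B"
    by (auto simp: B_def vec_eq_iff adj_def matrix_matrix_mult_def map_matrix_def mat_def mult.commute)
  moreover have "0 \<le> Re (quad B w)" for w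
    unfolding quadB using power_mono[OF min[of w], of 2] by (simp add: s_def)
  ultimately have "psd B" by (simp add: psd_def)
  moreover have "Re (quad B v) = 0"
    using assms(1) by (simp add: quadB s_def)
  ultimately have "B *v v = 0" by (simp add: psd_quad_eq_0_iff)
  then show ?thesis by (simp add: B s_def)
qed

text \<open>A positive minimal stretch comes with its left singular vector. The value 0 also demands a unit
vector in the kernel of the adjoint, which a wide matrix may fail to have; the hypothesis
provides it.\<close>

lemma sigma_min_eq:
  fixes A :: "complex^'k^'m"
  assumes null: "\<And>v. norm v = 1 \<Longrightarrow> A *v v = 0 \<Longrightarrow> \<exists>u. norm u = 1 \<and> adj A *v u = 0"
  obtains v where "norm v = 1" and "sigma_min A = norm (A *v v)"
    and "\<And>w. sigma_min A * norm w \<le> norm (A *v w)"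
proof -
  obtain v where v: "norm v = 1" and min: "\<And>w. norm (A *v v) * norm w \<le> norm (A *v w)"
    using minimal_stretch_attained by blast
  define s where "s = norm (A *v v)"
  have "singular_value A s"
  proof (cases "s = 0")
    case True
    then have "A *v v = 0" by (simp add: s_def)
    with null[OF v] obtain u where "norm u = 1" "adj A *v u = 0" by blast
    then show ?thesis
      using v True by (auto simp: singular_value_def s_def)
  next
    case False
    define u where "u = (1 / complex_of_real s) *s (A *v v)"
    have "norm u = 1" using False by (simp add: u_def norm_vec_scale norm_divide s_def)
    moreover have "A *v v = complex_of_real s *s u"
      using False by (simp add: u_def vec_eq_iff)
    moreover have "adj A *v u = complex_of_real s *s v"
      using False gram_eigenvector[OF v min]
      by (simp add: u_def s_def[symmetric] vector_scalar_commute vec_eq_iff power2_eq_square)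
    ultimately show ?thesis using v by (auto simp: singular_value_def s_def)
  qed
  moreover have "s \<le> t" if t: "singular_value A t" for t
  proof -
    obtain w where "norm w = 1" "norm (A *v w) = t"
      using singular_value_attained[OF t] .
    then show ?thesis using min[of w] by (simp add: s_def)
  qed
  ultimately have "sigma_min A = s"
    unfolding sigma_min_def by (rule Least_equality)
  then show thesis
    using that[OF v] min by (simp add: s_def)
qed

section \<open>Orthonormal bases as isometries\<close>

lemma columns_onb_gram:
  assumes "columns_onb U S"
  shows "adj U ** U = mat 1"
  using assms
  by (simp add: columns_onb_def cinner_def column_def vec_eq_iff adj_def matrix_matrix_mult_def mat_def)

lemma columns_onb_isometry:
  assumes "columns_onb U S"
  shows "norm (U *v v) = norm v"
proof -
  have "(norm (U *v v))\<^sup>2 = (norm v)\<^sup>2"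
    using quad_gram[of U v] columns_onb_gram[OF assms]
    by (simp add: quad_def cinner_self flip: of_real_power)
  then show ?thesis by simp
qed

lemma columns_onb_range:
  fixes U :: "complex^'k^'n"
  assumes "columns_onb U S"
  shows "range ((*v) U) = S"
proof
  have S: "S = vec.span (columns U)" using assms by (simp add: columns_onb_def)
  show "range ((*v) U) \<subseteq> S"
    unfolding S by (auto intro: matrix_vector_mult_in_columnspace_gen)
  have "vec.span (columns U) \<subseteq> range ((*v) U)"
  proof (rule vec.span_minimal)
    show "columns U \<subseteq> range ((*v) U)"
    proof
      fix c assume "c \<in> columns U"
      then obtain i where "c = column i U" by (auto simp: columns_def)
      also have "\<dots> = U *v axis i 1"
        by (simp add: vec_eq_iff column_def matrix_vector_mult_def axis_def if_distrib cong: if_cong)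
      finally show "c \<in> range ((*v) U)" by simp
    qed
    show "vec.subspace (range ((*v) U))"
    proof (rule vec.subspaceI)
      show "0 \<in> range ((*v) U)" by (rule range_eqI[of _ _ 0]) simp
      fix x y assume "x \<in> range ((*v) U)" "y \<in> range ((*v) U)"
      then show "x + y \<in> range ((*v) U)"
        by (auto simp flip: matrix_vector_right_distrib)
    next
      fix c x assume "x \<in> range ((*v) U)"
      then show "c *s x \<in> range ((*v) U)"
        by (auto simp flip: vector_scalar_commute)
    qed
  qed
  then show "S \<subseteq> range ((*v) U)" unfolding S .
qed

text \<open>If \<open>J U\<close> has the singular value 0 at \<open>v\<close>, then \<open>U v\<close> is also a left singular vector, because
\<open>(J U)\<^sup>* (U v) = - U\<^sup>*J U v = 0\<close>. This makes the characterization of \<open>sigma_min\<close> applicable.\<close>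

lemma INF_quot_skew_sigma_min:
  fixes J :: "complex^'n^'n" and U :: "complex^'k^'n"
  assumes skew: "skew_herm J" and U: "columns_onb U S"
  shows "(INF a \<in> S - {0}. ereal (quot_skew J a)) = ereal ((sigma_min (J ** U))\<^sup>2)"
proof -
  have null: "\<exists>u. norm u = 1 \<and> adj (J ** U) *v u = 0" if "norm v = 1" "(J ** U) *v v = 0" for v
  proof (intro exI conjI)
    show "norm (U *v v) = 1" using that by (simp add: columns_onb_isometry[OF U])
    have "J *v (U *v v) = 0" using that(2) by (simp add: matrix_vector_mul_assoc)
    then show "adj (J ** U) *v (U *v v) = 0"
      using skew
      by (simp add: adj_mult skew_herm_def matrix_vector_mul_assoc[symmetric]
          uminus_matrix_vector_mult del: matrix_vector_mul_assoc)
  qed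
  obtain v where v: "norm v = 1" "sigma_min (J ** U) = norm ((J ** U) *v v)"
    and min: "\<And>w. sigma_min (J ** U) * norm w \<le> norm ((J ** U) *v w)"
    by (rule sigma_min_eq[of "J ** U"]) (use null in blast, blast)
  have quot: "quot_skew J (U *v w) = (norm ((J ** U) *v w) / norm w)\<^sup>2" for w
    by (simp add: quot_skew_eq columns_onb_isometry[OF U] matrix_vector_mul_assoc)
  show ?thesis
  proof (rule antisym)
    have "U *v v \<in> S - {0}"
      using columns_onb_range[OF U] columns_onb_isometry[OF U, of v] v(1) by auto
    then show "(INF a \<in> S - {0}. ereal (quot_skew J a)) \<le> ereal ((sigma_min (J ** U))\<^sup>2)"
      by (rule INF_lower2) (simp add: quot v)
    show "ereal ((sigma_min (J ** U))\<^sup>2) \<le> (INF a \<in> S - {0}. ereal (quot_skew J a))"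
    proof (rule INF_greatest)
      fix a assume "a \<in> S - {0}"
      then obtain w where a: "a = U *v w"
        using columns_onb_range[OF U] by auto
      with \<open>a \<in> S - {0}\<close> have "w \<noteq> 0" by auto
      then have "sigma_min (J ** U) \<le> norm ((J ** U) *v w) / norm w"
        using min[of w] by (simp add: field_simps)
      then show "ereal ((sigma_min (J ** U))\<^sup>2) \<le> ereal (quot_skew J a)"
        by (simp add: a quot power_mono v(2))
    qed
  qed
qed

section \<open>Distances as infima of quotients\<close>

text \<open>Squaring commutes with infima of nonnegative quantities, and the infimum is unchanged when the
costs of all admissible perturbations are replaced by a family that bounds them from below and
is reached. Both sides are \<open>\<infinity>\<close> when there is nothing to range over.\<close>

lemma Inf_square_eq_INF:
  fixes S :: "real set" and f :: "'a \<Rightarrow> real"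
  assumes "\<And>s. s \<in> S \<Longrightarrow> 0 \<le> s" and "\<And>a. a \<in> T \<Longrightarrow> 0 \<le> f a"
    and lower: "\<And>s. s \<in> S \<Longrightarrow> \<exists>a\<in>T. f a \<le> s\<^sup>2"
    and upper: "\<And>a. a \<in> T \<Longrightarrow> \<exists>s\<in>S. s\<^sup>2 \<le> f a"
  shows "(Inf (ereal ` S))\<^sup>2 = (INF a\<in>T. ereal (f a))"
proof (rule antisym)
  have nonneg: "0 \<le> Inf (ereal ` S)"
    using assms(1) by (auto intro: INF_greatest)
  show "(Inf (ereal ` S))\<^sup>2 \<le> (INF a\<in>T. ereal (f a))"
  proof (rule INF_greatest)
    fix a assume "a \<in> T"
    then obtain s where s: "s \<in> S" "s\<^sup>2 \<le> f a" using upper by blast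
    have "Inf (ereal ` S) \<le> ereal s" using s by (auto intro: INF_lower)
    then have "(Inf (ereal ` S))\<^sup>2 \<le> (ereal s)\<^sup>2"
      using nonneg by (simp only: power2_eq_square) (intro ereal_mult_mono, use assms(1) s in auto)
    also have "\<dots> \<le> ereal (f a)" using s by simp
    finally show "(Inf (ereal ` S))\<^sup>2 \<le> ereal (f a)" .
  qed
  define m where "m = (INF a\<in>T. ereal (f a))"
  have "0 \<le> m" using assms(2) by (auto simp: m_def intro: INF_greatest)
  have m: "m \<le> ereal (s\<^sup>2)" if "s \<in> S" for s
    using lower[OF that] by (auto simp: m_def intro: INF_lower2)
  show "m \<le> (Inf (ereal ` S))\<^sup>2"
  proof (cases m)
    case (real M)
    then have M: "0 \<le> M" "\<And>s. s \<in> S \<Longrightarrow> M \<le> s\<^sup>2"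
      using \<open>0 \<le> m\<close> m by auto
    have "ereal (sqrt M) \<le> Inf (ereal ` S)"
    proof (rule INF_greatest)
      fix s assume "s \<in> S"
      then show "ereal (sqrt M) \<le> ereal s"
        using M(2) assms(1) by (simp add: real_le_lsqrt)
    qed
    then have "(ereal (sqrt M))\<^sup>2 \<le> (Inf (ereal ` S))\<^sup>2"
      using M(1) nonneg by (simp only: power2_eq_square) (intro ereal_mult_mono, auto)
    then show ?thesis using M(1) real by simp
  next
    case PInf
    then have "S = {}" using m by auto
    then show ?thesis by (simp add: power2_eq_square top_ereal_def)
  next
    case MInf
    then show ?thesis using \<open>0 \<le> m\<close> by simp
  qed
qed

lemma zero_in_ker: "0 \<in> ker A"
  by (simp add: ker_def)

lemma quot_skew_nonneg: "0 \<le> quot_skew J a"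
  by (simp add: quot_skew_eq)

lemma dist_JRE_square:
  fixes J R E :: "complex^'n^'n"
  assumes "skew_herm J" "psd R" "psd E"
  shows "(dist_JRE J R E)\<^sup>2 =
    (INF a \<in> - {0}. ereal (quot_skew J a + (quot_herm R a)\<^sup>2 + (quot_herm E a)\<^sup>2))"
proof -
  define S where "S = {sqrt ((spec_norm DJ)\<^sup>2 + (spec_norm DR)\<^sup>2 + (spec_norm DE)\<^sup>2) | DJ DR DE.
    skew_herm DJ \<and> nsd DR \<and> nsd DE \<and> psd (R + DR) \<and> psd (E + DE) \<and>
    ker (E + DE) \<inter> ker (R + DR) \<inter> ker (J + DJ) \<noteq> {0}}"
  have "dist_JRE J R E = Inf (ereal ` S)"
    unfolding dist_JRE_def S_def by (rule arg_cong[where f = Inf]) blast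
  also have "\<dots>\<^sup>2 = (INF a \<in> - {0}. ereal (quot_skew J a + (quot_herm R a)\<^sup>2 + (quot_herm E a)\<^sup>2))"
  proof (rule Inf_square_eq_INF)
    fix s assume s: "s \<in> S"
    then obtain DJ DR DE where D: "skew_herm DJ" "nsd DR" "nsd DE"
      and "ker (E + DE) \<inter> ker (R + DR) \<inter> ker (J + DJ) \<noteq> {0}"
      and s: "s = sqrt ((spec_norm DJ)\<^sup>2 + (spec_norm DR)\<^sup>2 + (spec_norm DE)\<^sup>2)"
      unfolding S_def by blast
    then obtain a where a: "a \<in> ker (E + DE)" "a \<in> ker (R + DR)" "a \<in> ker (J + DJ)" "a \<noteq> 0"
      using zero_in_ker by blast
    have "quot_skew J a + (quot_herm R a)\<^sup>2 + (quot_herm E a)\<^sup>2 \<le> s\<^sup>2"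
      using skew_perturbation_lower[OF a(3,4)] psd_perturbation_lower[OF assms(2) D(2) a(2)]
        psd_perturbation_lower[OF assms(3) D(3) a(1)]
      by (simp add: s)
    then show "\<exists>a\<in>- {0}. quot_skew J a + (quot_herm R a)\<^sup>2 + (quot_herm E a)\<^sup>2 \<le> s\<^sup>2"
      using a(4) by blast
    show "0 \<le> s" by (simp add: s)
  next
    fix a :: "complex^'n" assume a: "a \<in> - {0}"
    show "0 \<le> quot_skew J a + (quot_herm R a)\<^sup>2 + (quot_herm E a)\<^sup>2"
      by (simp add: quot_skew_nonneg)
    obtain DJ where DJ: "skew_herm DJ" "a \<in> ker (J + DJ)" "(spec_norm DJ)\<^sup>2 \<le> quot_skew J a"
      using skew_perturbation_exists[OF assms(1)] a by blast
    obtain DR where DR: "nsd DR" "psd (R + DR)" "a \<in> ker (R + DR)"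
      "(spec_norm DR)\<^sup>2 \<le> (quot_herm R a)\<^sup>2"
      using psd_perturbation_exists[OF assms(2)] by blast
    obtain DE where DE: "nsd DE" "psd (E + DE)" "a \<in> ker (E + DE)"
      "(spec_norm DE)\<^sup>2 \<le> (quot_herm E a)\<^sup>2"
      using psd_perturbation_exists[OF assms(3)] by blast
    define s where "s = sqrt ((spec_norm DJ)\<^sup>2 + (spec_norm DR)\<^sup>2 + (spec_norm DE)\<^sup>2)"
    have "ker (E + DE) \<inter> ker (R + DR) \<inter> ker (J + DJ) \<noteq> {0}"
      using a DJ(2) DR(3) DE(3) by auto
    then have "s \<in> S"
      unfolding S_def s_def using DJ(1) DR(1,2) DE(1,2) by blast
    moreover have "s\<^sup>2 \<le> quot_skew J a + (quot_herm R a)\<^sup>2 + (quot_herm E a)\<^sup>2"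
      using DJ(3) DR(4) DE(4) by (simp add: s_def)
    ultimately show "\<exists>s\<in>S. s\<^sup>2 \<le> quot_skew J a + (quot_herm R a)\<^sup>2 + (quot_herm E a)\<^sup>2"
      by blast
  qed
  finally show ?thesis .
qed

lemma dist_JR_square:
  fixes J R E :: "complex^'n^'n"
  assumes "skew_herm J" "psd R"
  shows "(dist_JR J R E)\<^sup>2 =
    (INF a \<in> ker E - {0}. ereal (quot_skew J a + (quot_herm R a)\<^sup>2))"
proof -
  define S where "S = {sqrt ((spec_norm DJ)\<^sup>2 + (spec_norm DR)\<^sup>2) | DJ DR.
    skew_herm DJ \<and> nsd DR \<and> psd (R + DR) \<and>
    ker E \<inter> ker (R + DR) \<inter> ker (J + DJ) \<noteq> {0}}"
  have "dist_JR J R E = Inf (ereal ` S)"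
    unfolding dist_JR_def S_def by (rule arg_cong[where f = Inf]) blast
  also have "\<dots>\<^sup>2 = (INF a \<in> ker E - {0}. ereal (quot_skew J a + (quot_herm R a)\<^sup>2))"
  proof (rule Inf_square_eq_INF)
    fix s assume s: "s \<in> S"
    then obtain DJ DR where D: "skew_herm DJ" "nsd DR"
      and "ker E \<inter> ker (R + DR) \<inter> ker (J + DJ) \<noteq> {0}"
      and s: "s = sqrt ((spec_norm DJ)\<^sup>2 + (spec_norm DR)\<^sup>2)"
      unfolding S_def by blast
    then obtain a where a: "a \<in> ker E" "a \<in> ker (R + DR)" "a \<in> ker (J + DJ)" "a \<noteq> 0"
      using zero_in_ker by blast
    have "quot_skew J a + (quot_herm R a)\<^sup>2 \<le> s\<^sup>2"
      using skew_perturbation_lower[OF a(3,4)] psd_perturbation_lower[OF assms(2) D(2) a(2)]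
      by (simp add: s)
    then show "\<exists>a\<in>ker E - {0}. quot_skew J a + (quot_herm R a)\<^sup>2 \<le> s\<^sup>2"
      using a by blast
    show "0 \<le> s" by (simp add: s)
  next
    fix a :: "complex^'n" assume a: "a \<in> ker E - {0}"
    show "0 \<le> quot_skew J a + (quot_herm R a)\<^sup>2"
      by (simp add: quot_skew_nonneg)
    obtain DJ where DJ: "skew_herm DJ" "a \<in> ker (J + DJ)" "(spec_norm DJ)\<^sup>2 \<le> quot_skew J a"
      using skew_perturbation_exists[OF assms(1)] a by blast
    obtain DR where DR: "nsd DR" "psd (R + DR)" "a \<in> ker (R + DR)"
      "(spec_norm DR)\<^sup>2 \<le> (quot_herm R a)\<^sup>2"
      using psd_perturbation_exists[OF assms(2)] by blast
    define s where "s = sqrt ((spec_norm DJ)\<^sup>2 + (spec_norm DR)\<^sup>2)"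
    have "ker E \<inter> ker (R + DR) \<inter> ker (J + DJ) \<noteq> {0}"
      using a DJ(2) DR(3) by auto
    then have "s \<in> S"
      unfolding S_def s_def using DJ(1) DR(1,2) by blast
    moreover have "s\<^sup>2 \<le> quot_skew J a + (quot_herm R a)\<^sup>2"
      using DJ(3) DR(4) by (simp add: s_def)
    ultimately show "\<exists>s\<in>S. s\<^sup>2 \<le> quot_skew J a + (quot_herm R a)\<^sup>2"
      by blast
  qed
  finally show ?thesis .
qed

lemma dist_JE_eq_dist_JR: "dist_JE J R E = dist_JR J E R"
  unfolding dist_JE_def dist_JR_def
  by (simp only: Int_commute[of "ker (E + _)" "ker R"])

lemma dist_J_square:
  fixes J R E :: "complex^'n^'n"
  assumes "skew_herm J"
  shows "(dist_J J R E)\<^sup>2 = (INF a \<in> ker R \<inter> ker E - {0}. ereal (quot_skew J a))"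
proof -
  define S where "S = {spec_norm DJ | DJ. skew_herm DJ \<and> ker E \<inter> ker R \<inter> ker (J + DJ) \<noteq> {0}}"
  have "dist_J J R E = Inf (ereal ` S)"
    unfolding dist_J_def S_def by (rule arg_cong[where f = Inf]) blast
  also have "\<dots>\<^sup>2 = (INF a \<in> ker R \<inter> ker E - {0}. ereal (quot_skew J a))"
  proof (rule Inf_square_eq_INF)
    fix s assume "s \<in> S"
    then obtain DJ where "ker E \<inter> ker R \<inter> ker (J + DJ) \<noteq> {0}" and s: "s = spec_norm DJ"
      unfolding S_def by blast
    then obtain a where a: "a \<in> ker R \<inter> ker E - {0}" "a \<in> ker (J + DJ)"
      using zero_in_ker by blast
    then have "quot_skew J a \<le> s\<^sup>2"
      using skew_perturbation_lower[of a J DJ] by (simp add: s)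
    with a(1) show "\<exists>a\<in>ker R \<inter> ker E - {0}. quot_skew J a \<le> s\<^sup>2" by blast
    show "0 \<le> s" by (simp add: s spec_norm_nonneg)
  next
    fix a :: "complex^'n" assume a: "a \<in> ker R \<inter> ker E - {0}"
    obtain DJ where DJ: "skew_herm DJ" "a \<in> ker (J + DJ)" "(spec_norm DJ)\<^sup>2 \<le> quot_skew J a"
      using skew_perturbation_exists[OF assms] a by blast
    then have "spec_norm DJ \<in> S"
      using a unfolding S_def by blast
    with DJ(3) show "\<exists>s\<in>S. s\<^sup>2 \<le> quot_skew J a" by blast
  qed (rule quot_skew_nonneg)
  finally show ?thesis .
qed

section \<open>Splitting the index sets along the kernels\<close>

lemma INF_split_kernel:
  fixes f :: "complex^'n \<Rightarrow> ereal"
  shows "(INF a \<in> V - {0}. f a) =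
    min (INF a \<in> V \<inter> ker A - {0}. f a) (INF a \<in> V \<inter> - ker A. f a)"
proof -
  have "V - {0} = (V \<inter> ker A - {0}) \<union> (V \<inter> - ker A)"
    using zero_in_ker by auto
  then show ?thesis by (simp only: INF_union inf_min)
qed

text \<open>On \<open>ker E \<inter> ker R\<close> the semidefinite quotient vanishes and what remains is the cost that defines
\<open>dist_J\<close>.\<close>

lemma dist_JR_square_split:
  assumes "skew_herm J" "psd R"
  shows "(dist_JR J R E)\<^sup>2 =
    (if ker E = {0} then \<infinity>
     else min ((dist_J J R E)\<^sup>2)
       (INF a \<in> ker E \<inter> - ker R. ereal (quot_skew J a + (quot_herm R a)\<^sup>2)))"
proof (cases "ker E = {0}")
  case True
  then show ?thesis by (simp add: dist_JR_square[OF assms] top_ereal_def)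
next
  case False
  have "(dist_J J R E)\<^sup>2 =
      (INF a \<in> ker E \<inter> ker R - {0}. ereal (quot_skew J a + (quot_herm R a)\<^sup>2))"
    unfolding dist_J_square[OF assms(1)]
    by (rule INF_cong) (auto simp: quot_herm_kernel)
  then show ?thesis
    using False by (simp add: dist_JR_square[OF assms] INF_split_kernel[where V = "ker E" and A = R])
qed

lemma dist_J_commute: "dist_J J R E = dist_J J E R"
  unfolding dist_J_def by (simp only: Int_commute[of "ker E" "ker R"])

theorem theorem3p9:
  fixes J R E :: "complex^'n^'n"
  assumes "skew_herm J" and "psd R" and "psd E" and "regular_pencil (J - R) E"
  shows
    "(dist_JRE J R E)\<^sup>2 =
        min ((dist_JR J R E)\<^sup>2) (min ((dist_JE J R E)\<^sup>2)
          (INF a \<in> - ker R \<inter> - ker E.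
            ereal (quot_skew J a + (quot_herm R a)\<^sup>2 + (quot_herm E a)\<^sup>2)))
     \<and>
     (dist_JR J R E)\<^sup>2 =
        (if ker E = {0} then \<infinity>
         else min ((dist_J J R E)\<^sup>2)
           (INF a \<in> ker E \<inter> - ker R. ereal (quot_skew J a + (quot_herm R a)\<^sup>2)))
     \<and>
     (dist_JE J R E)\<^sup>2 =
        (if ker R = {0} then \<infinity>
         else min ((dist_J J R E)\<^sup>2)
           (INF a \<in> ker R \<inter> - ker E. ereal (quot_skew J a + (quot_herm E a)\<^sup>2)))
     \<and>
     (if ker R \<inter> ker E = {0} then (dist_J J R E)\<^sup>2 = \<infinity>
      else \<forall>U :: complex^'k^'n. columns_onb U (ker R \<inter> ker E) \<longrightarrow>
        (dist_J J R E)\<^sup>2 = ereal ((sigma_min (J ** U))\<^sup>2))"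
proof (intro conjI)
  let ?f = "\<lambda>a. ereal (quot_skew J a + (quot_herm R a)\<^sup>2 + (quot_herm E a)\<^sup>2)"
  \<comment> \<open>On \<open>ker E\<close>, respectively \<open>ker R\<close>, one semidefinite quotient is 0, so that all four infima
    have the same integrand.\<close>
  have JR: "(dist_JR J R E)\<^sup>2 = (INF a \<in> ker E - {0}. ?f a)"
    unfolding dist_JR_square[OF assms(1,2)] by (rule INF_cong) (auto simp: quot_herm_kernel)
  have JE: "(dist_JE J R E)\<^sup>2 = (INF a \<in> ker R - {0}. ?f a)"
    unfolding dist_JE_eq_dist_JR dist_JR_square[OF assms(1,3)]
    by (rule INF_cong) (auto simp: quot_herm_kernel)
  \<comment> \<open>Vectors in both kernels are counted in two of the three pieces, which an infimum does not notice.\<close>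
  have "- {0} = (ker E - {0}) \<union> ((ker R - {0}) \<union> (- ker R \<inter> - ker E))"
    using zero_in_ker by auto
  then show "(dist_JRE J R E)\<^sup>2 =
      min ((dist_JR J R E)\<^sup>2) (min ((dist_JE J R E)\<^sup>2) (INF a \<in> - ker R \<inter> - ker E. ?f a))"
    unfolding dist_JRE_square[OF assms(1-3)] JR JE by (simp only: INF_union inf_min)
  show "(dist_JR J R E)\<^sup>2 =
      (if ker E = {0} then \<infinity>
       else min ((dist_J J R E)\<^sup>2)
         (INF a \<in> ker E \<inter> - ker R. ereal (quot_skew J a + (quot_herm R a)\<^sup>2)))"
    by (rule dist_JR_square_split[OF assms(1,2)])
  show "(dist_JE J R E)\<^sup>2 =
      (if ker R = {0} then \<infinity>
       else min ((dist_J J R E)\<^sup>2)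
         (INF a \<in> ker R \<inter> - ker E. ereal (quot_skew J a + (quot_herm E a)\<^sup>2)))"
    unfolding dist_JE_eq_dist_JR dist_J_commute[of J R E]
    by (rule dist_JR_square_split[OF assms(1,3)])
  show "if ker R \<inter> ker E = {0} then (dist_J J R E)\<^sup>2 = \<infinity>
      else \<forall>U :: complex^'k^'n. columns_onb U (ker R \<inter> ker E) \<longrightarrow>
        (dist_J J R E)\<^sup>2 = ereal ((sigma_min (J ** U))\<^sup>2)"
    by (simp add: dist_J_square[OF assms(1)] INF_quot_skew_sigma_min[OF assms(1)] top_ereal_def)
qed

end
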